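(* Let $\alpha\in[0,1)$. The Price of Anarchy of mixed Platform Equilibrium when the platform sets transaction fee $\alpha$ is at most $\frac{2-\alpha}{1-\alpha}$: for every market $(S,B,\mathbf v,G)$ and every mixed Platform Equilibrium $\mathbf x\in[0,1]^S$ at fee $\alpha$, $$W^\star(S,B,\mathbf v)\le\frac{2-\alpha}{1-\alpha}\,\mathbb E_{P\sim\mathbf x}\big[W(S,B,G(P))\big].$$
   Context: A market $(S,B,\mathbf v,G)$ consists of a finite set $B=\{1,\dots,n\}$ of buyers, a finite set $S=\{1,\dots,m\}$ of sellers (each owning one item), values $v_{ij}\ge 0$ of buyer $i$ for seller $j$'s item (each buyer is unit-demand), and a bipartite graph $G$ between $B$ and $S$ whose edges are the pairs that can transact directly. $W(S',B',G)$ denotes the maximum of $\sum v_{ij}$ over matchings between $B'\subseteq B$ and $S'\subseteq S$ that use only edges of $G$. The optimal welfare $W^\star(S,B,\mathbf v)$ is $W(S,B,K)$ where $K$ is the complete bipartite graph between $B$ and $S$. For a set $P\subseteq S$ of sellers joining the platform, $G(P)$ is the graph obtained from $G$ by adding all edges between $P$ and $B$. The market then clears at the maximum competitive (Walrasian) equilibrium prices with respect to $G(P)$, which equal $p_j(P)=W(S,B,G(P))-W(S\setminus\{j\},B,G(P))$, and the resulting social welfare is $W(S,B,G(P))$. At fee $\alpha$, seller $j$ has utility $u_j(P,\alpha)=(1-\alpha)p_j(P)$ if $j\in P$ and $u_j(P,\alpha)=p_j(P)$ if $j\notin P$. A vector $\mathbf x=(x_j)_{j\in S}\in[0,1]^S$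 denotes the profile where each seller $j$ independently joins with probability $x_j$; $P\sim\mathbf x$ is the resulting random set of joining sellers, and $P\sim\mathbf x_{-j}$ is the random set of joining sellers other than $j$. $\mathbf x$ is a mixed Platform Equilibrium at fee $\alpha$ if for every $j\in S$, $\mathbb E_{P\sim\mathbf x}[u_j(P,\alpha)]\ge\max\{\mathbb E_{P\sim\mathbf x_{-j}}[u_j(P,\alpha)],\ \mathbb E_{P\sim\mathbf x_{-j}}[u_j(P\cup\{j\},\alpha)]\}$. *)

theory Defs
  imports "HOL-Probability.Probability" "HOL-Probability.Product_PMF"
begin

text \<open>
  Bipartite graphs between buyers and sellers are sets of pairs (buyer, seller);
  the value of buyer \<open>i\<close> for the item of seller \<open>j\<close> is \<open>v i j\<close>.
\<close>

definition market ::
  "'s set \<Rightarrow> 'b set \<Rightarrow> ('b \<Rightarrow> 's \<Rightarrow> real) \<Rightarrow> ('b \<times> 's) set \<Rightarrow> bool" where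
  "market S B v G \<longleftrightarrow>
     finite S \<and> finite B \<and> (\<forall>i\<in>B. \<forall>j\<in>S. 0 \<le> v i j) \<and> G \<subseteq> B \<times> S"

definition matchings :: "'s set \<Rightarrow> 'b set \<Rightarrow> ('b \<times> 's) set \<Rightarrow> ('b \<times> 's) set set" where
  "matchings S B G = {M. M \<subseteq> G \<inter> (B \<times> S) \<and> inj_on fst M \<and> inj_on snd M}"

definition welfare ::
  "('b \<Rightarrow> 's \<Rightarrow> real) \<Rightarrow> 's set \<Rightarrow> 'b set \<Rightarrow> ('b \<times> 's) set \<Rightarrow> real" where
  "welfare v S B G = Max ((\<lambda>M. \<Sum>(i, j)\<in>M. v i j) ` matchings S B G)"

definition opt_welfare :: "('b \<Rightarrow> 's \<Rightarrow> real) \<Rightarrow> 's set \<Rightarrow> 'b set \<Rightarrow> real" where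
  "opt_welfare v S B = welfare v S B (B \<times> S)"

definition platform_graph ::
  "'b set \<Rightarrow> ('b \<times> 's) set \<Rightarrow> 's set \<Rightarrow> ('b \<times> 's) set" where
  "platform_graph B G P = G \<union> B \<times> P"

text \<open>
  The maximum competitive equilibrium price of an item is the marginal contribution of its
  seller to the welfare in \<open>G(P)\<close>.
\<close>

definition price ::
  "('b \<Rightarrow> 's \<Rightarrow> real) \<Rightarrow> 's set \<Rightarrow> 'b set \<Rightarrow> ('b \<times> 's) set \<Rightarrow> 's set \<Rightarrow> 's \<Rightarrow> real" where
  "price v S B G P j =
     welfare v S B (platform_graph B G P) - welfare v (S - {j}) B (platform_graph B G P)"

definition seller_utility ::
  "('b \<Rightarrow> 's \<Rightarrow> real) \<Rightarrow> 's set \<Rightarrow> 'b set \<Rightarrow> ('b \<times> 's) set \<Rightarrow> real \<Rightarrow> 's set \<Rightarrow> 's \<Rightarrow> real" where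
  "seller_utility v S B G \<alpha> P j =
     (if j \<in> P then (1 - \<alpha>) * price v S B G P j else price v S B G P j)"

text \<open>
  The random set of joining sellers when every \<open>j \<in> A\<close> joins independently with probability
  \<open>x j\<close>. Thus \<open>P \<sim> x\<close> is \<open>joining_pmf S x\<close> and \<open>P \<sim> x\<^sub>-\<^sub>j\<close> is \<open>joining_pmf (S - {j}) x\<close>.
\<close>

definition joining_pmf :: "'s set \<Rightarrow> ('s \<Rightarrow> real) \<Rightarrow> 's set pmf" where
  "joining_pmf A x = map_pmf (\<lambda>f. {j \<in> A. f j}) (Pi_pmf A False (\<lambda>j. bernoulli_pmf (x j)))"

definition mixed_platform_equilibrium ::
  "('b \<Rightarrow> 's \<Rightarrow> real) \<Rightarrow> 's set \<Rightarrow> 'b set \<Rightarrow> ('b \<times> 's) set \<Rightarrow> real \<Rightarrow> ('s \<Rightarrow> real) \<Rightarrow> bool" where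
  "mixed_platform_equilibrium v S B G \<alpha> x \<longleftrightarrow>
     (\<forall>j\<in>S. 0 \<le> x j \<and> x j \<le> 1) \<and>
     (\<forall>j\<in>S.
        measure_pmf.expectation (joining_pmf S x) (\<lambda>P. seller_utility v S B G \<alpha> P j) \<ge>
        max (measure_pmf.expectation (joining_pmf (S - {j}) x)
               (\<lambda>P. seller_utility v S B G \<alpha> P j))
            (measure_pmf.expectation (joining_pmf (S - {j}) x)
               (\<lambda>P. seller_utility v S B G \<alpha> (P \<union> {j}) j)))"

end

theory Submission
  imports Defs
begin

text \<open>
  Let \<open>N\<close> be an optimal matching of the complete graph and \<open>(i, j) \<in> N\<close>. If \<open>j\<close> joins, then \<open>i\<close> and
  \<open>j\<close> can be matched to each other, so \<open>p\<^sub>j(P \<union> {j}) \<ge> v\<^sub>i\<^sub>j + W(S - j, B - i) - W(S - j, B)\<close>, where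
  the welfares on the right are taken in \<open>G(P)\<close> and do not depend on whether \<open>j \<in> P\<close>. Hence the
  equilibrium condition gives a bound on \<open>v\<^sub>i\<^sub>j\<close> by the expectation over \<open>P \<sim> x\<close> of
  \<open>p\<^sub>j(P) / (1 - \<alpha>) + W(S - j, B) - W(S - j, B - i) =
  \<alpha> / (1 - \<alpha>) * p\<^sub>j(P) + W(S, B) - W(S - j, B - i)\<close>.
  Deleting vertices from an optimal matching \<open>M\<close> of \<open>G(P)\<close> costs at most the value of the \<open>M\<close>-edges at
  these vertices. Summed over \<open>N\<close>, the first term is therefore at most \<open>\<alpha> / (1 - \<alpha>) * W\<close> and the
  remaining difference at most \<open>2 * W\<close>, which adds up to \<open>(2 - \<alpha>) / (1 - \<alpha>) * W\<close>.
\<close>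

lemma finite_matchings:
  assumes "finite S" "finite B"
  shows "finite (matchings S B G)"
  by (rule finite_subset[of _ "Pow (B \<times> S)"]) (use assms in \<open>auto simp: matchings_def\<close>)

lemma finite_matching:
  assumes "finite S" "finite B" "M \<in> matchings S B G"
  shows "finite M"
  by (rule finite_subset[of _ "B \<times> S"]) (use assms in \<open>auto simp: matchings_def\<close>)

lemma welfare_ge:
  assumes "finite S" "finite B" "M \<in> matchings S B G"
  shows "sum (case_prod v) M \<le> welfare v S B G"
  unfolding welfare_def using assms by (intro Max_ge finite_imageI finite_matchings) auto

lemma welfare_attained:
  assumes "finite S" "finite B"
  obtains M where "M \<in> matchings S B G" "welfare v S B G = sum (case_prod v) M"
proof -
  have "{} \<in> matchings S B G"
    by (simp add: matchings_def)
  then have "welfare v S B G \<in> (\<lambda>M. sum (case_prod v) M) ` matchings S B G"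
    unfolding welfare_def using finite_matchings[OF assms] by (intro Max_in) auto
  then show thesis
    using that by auto
qed

lemma welfare_mono:
  assumes "finite S" "finite B" "S' \<subseteq> S"
  shows "welfare v S' B G \<le> welfare v S B G"
proof -
  obtain M where M: "M \<in> matchings S' B G" "welfare v S' B G = sum (case_prod v) M"
    using welfare_attained assms finite_subset by metis
  moreover have "M \<in> matchings S B G"
    using M(1) \<open>S' \<subseteq> S\<close> by (auto simp: matchings_def)
  ultimately show ?thesis
    using welfare_ge assms by metis
qed

text \<open>The edges of \<open>M\<close> that avoid all deleted vertices still form a matching of
  the smaller market. An edge with both ends deleted is counted twice on the right, which is
  harmless because values are nonnegative.\<close>

lemma welfare_loss_delete:
  assumes "finite S" "finite B" "\<And>i j. i \<in> B \<Longrightarrow> j \<in> S \<Longrightarrow> 0 \<le> v i j"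
    and M: "M \<in> matchings S B G" "welfare v S B G = sum (case_prod v) M"
  shows "welfare v S B G - welfare v (S - S') (B - B') G
    \<le> sum (case_prod v) {e \<in> M. fst e \<in> B'} + sum (case_prod v) {e \<in> M. snd e \<in> S'}"
proof -
  let ?X = "{e \<in> M. fst e \<in> B'}" and ?Y = "{e \<in> M. snd e \<in> S'}"
  let ?M' = "{e \<in> M. fst e \<notin> B' \<and> snd e \<notin> S'}"
  have fin: "finite M"
    using finite_matching assms by blast
  have nonneg: "0 \<le> case_prod v e" if "e \<in> M" for e
    using that M assms(3) by (auto simp: matchings_def)
  have "?M' \<in> matchings (S - S') (B - B') G"
    using M by (auto simp: matchings_def inj_on_def)
  then have "sum (case_prod v) ?M' \<le> welfare v (S - S') (B - B') G"
    using assms by (intro welfare_ge) auto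
  moreover have "sum (case_prod v) M = sum (case_prod v) ?M' + sum (case_prod v) (?X \<union> ?Y)"
    using fin by (subst sum.union_disjoint[symmetric]) (auto intro!: sum.cong)
  moreover have "sum (case_prod v) (?X \<union> ?Y) \<le> sum (case_prod v) ?X + sum (case_prod v) ?Y"
    using fin nonneg by (subst sum_Un) (auto intro!: sum_nonneg)
  ultimately show ?thesis
    using M(2) by linarith
qed

text \<open>Injectivity of \<open>f\<close> makes the fibers of \<open>g\<close> over the values
  \<open>f a\<close> disjoint, so each element of \<open>M\<close> is charged at most once.\<close>

lemma sum_fibers_le:
  fixes w :: "'a \<Rightarrow> real"
  assumes "finite M" "inj_on f N" "finite N" "\<And>e. e \<in> M \<Longrightarrow> 0 \<le> w e"
  shows "(\<Sum>a\<in>N. sum w {e \<in> M. g e \<in> {f a}}) \<le> sum w M"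
proof -
  have "(\<Sum>a\<in>N. sum w {e \<in> M. g e \<in> {f a}}) = sum w (\<Union>a\<in>N. {e \<in> M. g e \<in> {f a}})"
    using assms by (subst sum.UNION_disjoint) (auto simp: inj_on_def)
  also have "\<dots> \<le> sum w M"
    using assms by (intro sum_mono2) auto
  finally show ?thesis .
qed

text \<open>One optimal \<open>M\<close> serves for all edges of \<open>N\<close>. As
  \<open>N\<close> is a matching, each edge of \<open>M\<close> is charged at most once through its
  buyer and once through its seller, whence the factor 2; deleting only sellers leaves the seller
  charge alone.\<close>

lemma sum_welfare_loss_delete_edge:
  assumes "finite S" "finite B" "\<And>i j. i \<in> B \<Longrightarrow> j \<in> S \<Longrightarrow> 0 \<le> v i j"
    and N: "finite N" "inj_on fst N" "inj_on snd N"
  shows "(\<Sum>(i, j)\<in>N. welfare v S B G - welfare v (S - {j}) (B - {i}) G) \<le> 2 * welfare v S B G"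
    and "(\<Sum>(i, j)\<in>N. welfare v S B G - welfare v (S - {j}) B G) \<le> welfare v S B G"
proof -
  obtain M where M: "M \<in> matchings S B G" "welfare v S B G = sum (case_prod v) M"
    using welfare_attained assms(1,2) by metis
  have fin: "finite M"
    using finite_matching assms M by blast
  have nonneg: "0 \<le> case_prod v e" if "e \<in> M" for e
    using that M assms(3) by (auto simp: matchings_def)
  note loss = welfare_loss_delete[OF assms(1-3) M]
  have loss': "welfare v S B G - welfare v (S - S') B G \<le> sum (case_prod v) {e \<in> M. snd e \<in> S'}" for S'
    using loss[of S' "{}"] by simp
  let ?X = "\<lambda>e. sum (case_prod v) {e' \<in> M. fst e' \<in> {fst e}}"
  let ?Y = "\<lambda>e. sum (case_prod v) {e' \<in> M. snd e' \<in> {snd e}}"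
  have X: "sum ?X N \<le> welfare v S B G" and Y: "sum ?Y N \<le> welfare v S B G"
    unfolding M(2) using fin N nonneg by (intro sum_fibers_le; simp)+
  have "(\<Sum>(i, j)\<in>N. welfare v S B G - welfare v (S - {j}) (B - {i}) G) \<le> (\<Sum>e\<in>N. ?X e + ?Y e)"
    by (intro sum_mono) (simp only: case_prod_beta loss)
  also have "\<dots> \<le> 2 * welfare v S B G"
    using X Y by (simp add: sum.distrib)
  finally show "(\<Sum>(i, j)\<in>N. welfare v S B G - welfare v (S - {j}) (B - {i}) G)
    \<le> 2 * welfare v S B G" .
  have "(\<Sum>(i, j)\<in>N. welfare v S B G - welfare v (S - {j}) B G) \<le> sum ?Y N"
    by (intro sum_mono) (simp only: case_prod_beta loss')
  with Y show "(\<Sum>(i, j)\<in>N. welfare v S B G - welfare v (S - {j}) B G) \<le> welfare v S B G"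
    by linarith
qed

text \<open>Matchings into \<open>S\<close> cannot use the edges added at sellers outside
  \<open>S\<close>. In particular, the welfare without seller \<open>j\<close> does not depend on
  whether \<open>j\<close> joins.\<close>

lemma welfare_platform_graph_cong:
  assumes "P \<inter> S = Q \<inter> S"
  shows "welfare v S B (platform_graph B G P) = welfare v S B (platform_graph B G Q)"
proof -
  have "platform_graph B G P \<inter> (B' \<times> S) = platform_graph B G Q \<inter> (B' \<times> S)" for B'
    using assms by (auto simp: platform_graph_def)
  then show ?thesis
    by (simp add: welfare_def matchings_def)
qed

text \<open>Once \<open>j\<close> joins, the edge \<open>(i, j)\<close> is available and extends any
  matching that avoids both \<open>i\<close> and \<open>j\<close>.\<close>

lemma price_insert_ge:
  assumes "finite S" "finite B" "i \<in> B" "j \<in> S"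
  shows "v i j + welfare v (S - {j}) (B - {i}) (platform_graph B G P)
      - welfare v (S - {j}) B (platform_graph B G P)
    \<le> price v S B G (insert j P) j"
proof -
  obtain M where M: "M \<in> matchings (S - {j}) (B - {i}) (platform_graph B G P)"
      "welfare v (S - {j}) (B - {i}) (platform_graph B G P) = sum (case_prod v) M"
    using welfare_attained assms(1,2) by (metis finite_Diff)
  have "finite M"
    by (rule finite_matching[OF _ _ M(1)]) (use assms in auto)
  moreover have "(i, j) \<notin> M"
    using M(1) by (auto simp: matchings_def)
  ultimately have "sum (case_prod v) (insert (i, j) M) = v i j + sum (case_prod v) M"
    by simp
  moreover have "insert (i, j) M \<in> matchings S B (platform_graph B G (insert j P))"
    using M(1) assms by (fastforce simp: matchings_def platform_graph_def inj_on_def)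
  then have "sum (case_prod v) (insert (i, j) M) \<le> welfare v S B (platform_graph B G (insert j P))"
    using assms by (intro welfare_ge) auto
  moreover have "welfare v (S - {j}) B (platform_graph B G (insert j P)) =
      welfare v (S - {j}) B (platform_graph B G P)"
    by (rule welfare_platform_graph_cong) auto
  ultimately show ?thesis
    using M(2) by (simp add: price_def)
qed

lemma finite_set_joining_pmf:
  assumes "finite A"
  shows "finite (set_pmf (joining_pmf A x))"
  by (rule finite_subset[of _ "Pow A"]) (use assms in \<open>auto simp: joining_pmf_def\<close>)

lemma integrable_joining_pmf:
  fixes f :: "'s set \<Rightarrow> real"
  assumes "finite A"
  shows "integrable (measure_pmf (joining_pmf A x)) f"
  using assms by (intro integrable_measure_pmf_finite finite_set_joining_pmf)

lemma joining_pmf_subset: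
  assumes "finite A" "A' \<subseteq> A"
  shows "joining_pmf A' x = map_pmf (\<lambda>P. P \<inter> A') (joining_pmf A x)"
  using assms unfolding joining_pmf_def
  by (subst Pi_pmf_subset[OF assms]) (auto simp: pmf.map_comp o_def intro!: pmf.map_cong)

text \<open>This passes between \<alpha>-independent quantities under \<open>x\<close> and under
  \<open>x\<close> without seller \<open>j\<close>: by independence, the smaller random set is the
  restriction of the larger one.\<close>

lemma expectation_joining_pmf_subset:
  fixes f :: "'s set \<Rightarrow> real"
  assumes "finite A" "A' \<subseteq> A" "\<And>P. f (P \<inter> A') = f P"
  shows "measure_pmf.expectation (joining_pmf A' x) f = measure_pmf.expectation (joining_pmf A x) f"
  using assms(3) by (simp add: joining_pmf_subset[OF assms(1,2)])

theorem theorem5p2: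
  fixes S :: "'s set" and B :: "'b set"
    and v :: "'b \<Rightarrow> 's \<Rightarrow> real" and G :: "('b \<times> 's) set"
    and \<alpha> :: real and x :: "'s \<Rightarrow> real"
  assumes "0 \<le> \<alpha>" and "\<alpha> < 1"
    and "market S B v G"
    and "mixed_platform_equilibrium v S B G \<alpha> x"
  shows "opt_welfare v S B \<le>
    (2 - \<alpha>) / (1 - \<alpha>) *
      measure_pmf.expectation (joining_pmf S x) (\<lambda>P. welfare v S B (platform_graph B G P))"
proof -
  have fin: "finite S" "finite B" and nonneg: "\<And>i j. i \<in> B \<Longrightarrow> j \<in> S \<Longrightarrow> 0 \<le> v i j"
    using \<open>market S B v G\<close> by (auto simp: market_def)
  let ?W = "\<lambda>S' B' P. welfare v S' B' (platform_graph B G P)"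
  let ?E = "\<lambda>A. measure_pmf.expectation (joining_pmf A x)"
  let ?g = "\<lambda>i j P. \<alpha> / (1 - \<alpha>) * (?W S B P - ?W (S - {j}) B P)
    + (?W S B P - ?W (S - {j}) (B - {i}) P)"
  note int = integrable_joining_pmf[OF fin(1)]
  obtain N where N: "N \<in> matchings S B (B \<times> S)" "opt_welfare v S B = sum (case_prod v) N"
    unfolding opt_welfare_def using welfare_attained fin by metis
  have finN: "finite N"
    using finite_matching fin N by blast
  have edge: "v i j \<le> ?E S (?g i j)" if "(i, j) \<in> N" for i j
  proof -
    have ij: "i \<in> B" "j \<in> S"
      using that N(1) by (auto simp: matchings_def)
    let ?h = "\<lambda>P. v i j + ?W (S - {j}) (B - {i}) P - ?W (S - {j}) B P"
    have "(1 - \<alpha>) * ?E S ?h = ?E S (\<lambda>P. (1 - \<alpha>) * ?h P)"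
      by simp
    also have "\<dots> = ?E (S - {j}) (\<lambda>P. (1 - \<alpha>) * ?h P)"
    proof (rule expectation_joining_pmf_subset[symmetric])
      fix P
      have "?W (S - {j}) B' (P \<inter> (S - {j})) = ?W (S - {j}) B' P" for B'
        unfolding welfare_def matchings_def platform_graph_def
        by (rule arg_cong[where f = Max], rule image_cong[OF _ refl], rule Collect_cong) blast
      then show "(1 - \<alpha>) * ?h (P \<inter> (S - {j})) = (1 - \<alpha>) * ?h P"
        by simp
    qed (use fin in auto)
    also have "\<dots> \<le> ?E (S - {j}) (\<lambda>P. seller_utility v S B G \<alpha> (P \<union> {j}) j)"
    proof (rule integral_mono)
      fix P
      show "(1 - \<alpha>) * ?h P \<le> seller_utility v S B G \<alpha> (P \<union> {j}) j"
        using price_insert_ge[OF fin ij] \<open>\<alpha> < 1\<close> by (auto simp: seller_utility_def)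
    qed (use fin in \<open>auto intro!: integrable_joining_pmf\<close>)
    \<comment> \<open>Equilibrium condition against the deviation of joining for sure.\<close>
    also have "\<dots> \<le> ?E S (\<lambda>P. seller_utility v S B G \<alpha> P j)"
      using assms(4) ij by (auto simp: mixed_platform_equilibrium_def)
    \<comment> \<open>Prices are nonnegative, so paying the fee can only lower utility.\<close>
    also have "\<dots> \<le> ?E S (\<lambda>P. price v S B G P j)"
    proof (rule integral_mono[OF int int])
      fix P
      have "0 \<le> price v S B G P j"
        using welfare_mono[OF fin, of "S - {j}"] by (auto simp: price_def)
      then show "seller_utility v S B G \<alpha> P j \<le> price v S B G P j"
        using \<open>0 \<le> \<alpha>\<close> by (simp add: seller_utility_def mult_left_le_one_le \<open>\<alpha> < 1\<close> less_imp_le)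
    qed
    finally have "?E S ?h \<le> ?E S (\<lambda>P. price v S B G P j) / (1 - \<alpha>)"
      using \<open>\<alpha> < 1\<close> by (simp add: field_simps)
    moreover have "?E S ?h = v i j + ?E S (?W (S - {j}) (B - {i})) - ?E S (?W (S - {j}) B)"
      by (simp add: int)
    \<comment> \<open>Uses \<open>1 / (1 - \<alpha>) = \<alpha> / (1 - \<alpha>) + 1\<close> and the
      definition of the price.\<close>
    moreover have "?E S (?g i j) = ?E S (\<lambda>P. price v S B G P j) / (1 - \<alpha>)
        - ?E S (?W (S - {j}) (B - {i})) + ?E S (?W (S - {j}) B)"
      using \<open>\<alpha> < 1\<close> by (simp add: int price_def field_simps)
    ultimately show ?thesis
      by linarith
  qed
  have "opt_welfare v S B \<le> (\<Sum>(i, j)\<in>N. ?E S (?g i j))"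
    unfolding N(2) using edge by (intro sum_mono) auto
  \<comment> \<open>With the sum inside the expectation, the charging bounds apply to each realized
    \<open>P\<close> separately.\<close>
  also have "\<dots> = ?E S (\<lambda>P. \<Sum>(i, j)\<in>N. ?g i j P)"
    unfolding case_prod_unfold by (rule Bochner_Integration.integral_sum[OF int, symmetric])
  also have "\<dots> \<le> ?E S (\<lambda>P. (2 - \<alpha>) / (1 - \<alpha>) * ?W S B P)"
  proof (rule integral_mono[OF int int])
    fix P
    have inj: "inj_on fst N" "inj_on snd N"
      using N(1) by (auto simp: matchings_def)
    note loss = sum_welfare_loss_delete_edge[OF fin nonneg finN inj, where G = "platform_graph B G P"]
    have "(\<Sum>(i, j)\<in>N. ?g i j P) =
        \<alpha> / (1 - \<alpha>) * (\<Sum>(i, j)\<in>N. ?W S B P - ?W (S - {j}) B P)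
        + (\<Sum>(i, j)\<in>N. ?W S B P - ?W (S - {j}) (B - {i}) P)"
      by (simp only: case_prod_unfold sum.distrib sum_distrib_left)
    also have "\<dots> \<le> \<alpha> / (1 - \<alpha>) * ?W S B P + 2 * ?W S B P"
      by (intro add_mono mult_left_mono loss) (use assms(1,2) in auto)
    also have "\<dots> = (2 - \<alpha>) / (1 - \<alpha>) * ?W S B P"
      using \<open>\<alpha> < 1\<close> by (simp add: field_simps)
    finally show "(\<Sum>(i, j)\<in>N. ?g i j P) \<le> (2 - \<alpha>) / (1 - \<alpha>) * ?W S B P" .
  qed
  also have "\<dots> = (2 - \<alpha>) / (1 - \<alpha>) * ?E S (?W S B)"
    by simp
  finally show ?thesis .
qed

end
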